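(* Let $X=(X_1,\dots,X_d)$ be a random vector with law $\mathbb{P}_X$ on the Euclidean space $\mathcal{X}$, let $\mathcal{G}$ be a directed acyclic graph on the nodes $X_1,\dots,X_d$, and let $\overline{\mathbb{P}}_X=\prod_{l=1}^d\mathbb{P}_{X_l\mid \mathrm{pa}(X_l)}$. Assume that $\mathbb{P}_X$ is absolutely continuous with respect to $\overline{\mathbb{P}}_X$, with Radon-Nikodym derivative $f=d\mathbb{P}_X/d\overline{\mathbb{P}}_X$. For each $N$, let $\widehat{\mathbb{GDM}}^{(N)}(X,\mathcal{G})$ be the estimator defined in the context, computed from $N$ i.i.d. samples $x^{(1)},\dots,x^{(N)}$ from $\mathbb{P}_X$ with parameter $k=k_N\in\{1,2,\dots\}$. Suppose that: 1. $\lim_{N\to\infty}k_N=\infty$ and $\lim_{N\to\infty}\frac{k_N\log N}{N}=0$; 2. the set of discrete points $\{x\in\mathcal{X}: \mathbb{P}_X(\{x\})>0\}$ is finite; 3. $\int_{\mathcal{X}}|\log f(x)|\,d\mathbb{P}_X(x)<+\infty$; 4. $\frac{(k_N\log N)^2}{N}\to0$ as $N\to\infty$. Then $$\lim_{N\to\infty}\mathrm{Var}\left[\widehat{\mathbb{GDM}}^{(N)}(X,\mathcal{G})\right]=0.$$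
   Context: Setting. $X=(X_1,\dots,X_d)$ where each $X_l$ takes values in a Euclidean space, and $\mathcal{X}$ is the product of these spaces. For a sub-collection $S$ of the components, $\mathcal{S}$ is the corresponding product of spaces, $\mathbb{P}_S$ is the marginal law of $S$ under $\mathbb{P}_X$, and for $x\in\mathcal{X}$ (or a sample $x^{(i)}$) the corresponding projection to $\mathcal{S}$ is denoted $s$ (or $s^{(i)}$). $\mathrm{pa}(X_l)$ is the set of parents of $X_l$ in $\mathcal{G}$, possibly empty, and $\mathrm{pa+}(X_l)=(X_l,\mathrm{pa}(X_l))$. Graph-induced law. $\overline{\mathbb{P}}_X=\prod_{l=1}^d \mathbb{P}_{X_l\mid \mathrm{pa}(X_l)}$ is the probability measure on $\mathcal{X}$ that is a Bayesian network on $\mathcal{G}$ with the conditional law of $X_l$ given $\mathrm{pa}(X_l)$ equal to the one under $\mathbb{P}_X$ (the marginal law of $X_l$ if $\mathrm{pa}(X_l)=\emptyset$). Estimator. All distances are $\ell_\infty$ distances. For $i=1,\dots,N$: $\rho_{k,i}$ is the distance from $x^{(i)}$ to its $k$-th nearest neighbor among the other samples $\{x^{(j)}\}_{j\neq i}$ in $\mathcal{X}$; $\tilde{k}_i=|\{j\neq i:\|x^{(j)}-x^{(i)}\|_\infty\le\rho_{k,i}\}|$; and for $S=\mathrm{pa}(X_l)$ or $S=\mathrm{pa+}(X_l)$, $n_S^{(i)}=|\{j\ne i:\|s^{(j)}-s^{(i)}\|_\infty\le\rho_{k,i}\}|$. With $\psi$ the digamma function and $\mathbf{1}_{\{\cdot\}}$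 the indicator, let $$\zeta_i=\psi(\tilde{k}_i)+\sum_{l=1}^d\Big(\mathbf{1}_{\{\mathrm{pa}(X_l)\ne\emptyset\}}\log\big(n^{(i)}_{\mathrm{pa}(X_l)}+1\big)-\log\big(n^{(i)}_{\mathrm{pa+}(X_l)}+1\big)\Big),$$ $$\widehat{\mathbb{GDM}}^{(N)}(X,\mathcal{G})=\frac1N\sum_{i=1}^N\zeta_i+\Big(\sum_{l=1}^d\mathbf{1}_{\{\mathrm{pa}(X_l)=\emptyset\}}-1\Big)\log N.$$ It is defined for $N>k$. Variance is over the i.i.d. samples. *)

theory Defs
  imports "HOL-Probability.Probability"
begin

text \<open>
  The nodes are \<open>1, \<dots>, d\<close>; component \<open>l\<close> takes values in \<open>\<real>\<^sup>n\<close> with \<open>n = m l\<close>, so that the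
  components may have different dimensions. A point of a product of component spaces is a
  function \<open>x\<close> with \<open>x l j\<close> the \<open>j\<close>-th coordinate of component \<open>l\<close>.
\<close>

definition euclid :: "nat \<Rightarrow> (nat \<Rightarrow> real) measure" where
  "euclid n = (\<Pi>\<^sub>M j\<in>{..<n}. borel)"

definition prod_space :: "(nat \<Rightarrow> nat) \<Rightarrow> nat set \<Rightarrow> (nat \<Rightarrow> nat \<Rightarrow> real) measure" where
  "prod_space m S = (\<Pi>\<^sub>M l\<in>S. euclid (m l))"

definition marginal ::
  "(nat \<Rightarrow> nat) \<Rightarrow> nat set \<Rightarrow> (nat \<Rightarrow> nat \<Rightarrow> real) measure \<Rightarrow> (nat \<Rightarrow> nat \<Rightarrow> real) measure" where
  "marginal m S P = distr P (prod_space m S) (\<lambda>x. restrict x S)"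

text \<open>The element \<open>0\<close> only matters when there are no coordinates at all.\<close>

definition linf_dist ::
  "(nat \<Rightarrow> nat) \<Rightarrow> nat set \<Rightarrow> (nat \<Rightarrow> nat \<Rightarrow> real) \<Rightarrow> (nat \<Rightarrow> nat \<Rightarrow> real) \<Rightarrow> real" where
  "linf_dist m S x y = Max (insert 0 {\<bar>x l j - y l j\<bar> | l j. l \<in> S \<and> j < m l})"

definition is_dag :: "nat \<Rightarrow> (nat \<times> nat) set \<Rightarrow> bool" where
  "is_dag d G \<longleftrightarrow> G \<subseteq> {1..d} \<times> {1..d} \<and> acyclic G"

definition pa :: "(nat \<times> nat) set \<Rightarrow> nat \<Rightarrow> nat set" where
  "pa G l = {j. (j, l) \<in> G}"

text \<open>
  \<open>\<kappa>\<close> is (a version of) the regular conditional law of component \<open>l\<close> given the components in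
  \<open>S\<close> under \<open>P\<close>. If \<open>S = {}\<close>, then \<open>prod_space m S\<close> has a single point, and \<open>\<kappa>\<close> is the marginal
  law of component \<open>l\<close> there.
\<close>

definition cond_law ::
  "(nat \<Rightarrow> nat) \<Rightarrow> (nat \<Rightarrow> nat \<Rightarrow> real) measure \<Rightarrow> nat \<Rightarrow> nat set \<Rightarrow>
    ((nat \<Rightarrow> nat \<Rightarrow> real) \<Rightarrow> (nat \<Rightarrow> real) measure) \<Rightarrow> bool" where
  "cond_law m P l S \<kappa> \<longleftrightarrow>
     \<kappa> \<in> prod_space m S \<rightarrow>\<^sub>M prob_algebra (euclid (m l)) \<and>
     (\<forall>A\<in>sets (prod_space m S). \<forall>B\<in>sets (euclid (m l)).
        emeasure P {x \<in> space P. restrict x S \<in> A \<and> x l \<in> B} =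
        (\<integral>\<^sup>+s\<in>A. emeasure (\<kappa> s) B \<partial>marginal m S P))"

text \<open>
  The product of the kernels \<open>\<kappa> l\<close> along a topological ordering of the graph. The list is in
  reverse order: every node precedes its parents.
\<close>

definition rev_topological :: "nat \<Rightarrow> (nat \<times> nat) set \<Rightarrow> nat list \<Rightarrow> bool" where
  "rev_topological d G ls \<longleftrightarrow> distinct ls \<and> set ls = {1..d} \<and>
     (\<forall>i<length ls. pa G (ls ! i) \<subseteq> set (drop (Suc i) ls))"

primrec kernel_prod ::
  "(nat \<Rightarrow> nat) \<Rightarrow> (nat \<times> nat) set \<Rightarrow>
    (nat \<Rightarrow> (nat \<Rightarrow> nat \<Rightarrow> real) \<Rightarrow> (nat \<Rightarrow> real) measure) \<Rightarrow> nat list \<Rightarrow>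
    (nat \<Rightarrow> nat \<Rightarrow> real) measure" where
  "kernel_prod m G \<kappa> [] = return (prod_space m {}) (\<lambda>_. undefined)"
| "kernel_prod m G \<kappa> (l # ls) =
     kernel_prod m G \<kappa> ls \<bind>
       (\<lambda>x. distr (\<kappa> l (restrict x (pa G l))) (prod_space m (insert l (set ls))) (\<lambda>y. x(l := y)))"

text \<open>
  A conditional law is only determined up to a null set of parent values under \<open>P\<close>, and such
  a set need not be null under the product. So this is a predicate, satisfied by the products
  of all versions of the conditional laws.
\<close>

definition graph_induced_law ::
  "nat \<Rightarrow> (nat \<Rightarrow> nat) \<Rightarrow> (nat \<times> nat) set \<Rightarrow> (nat \<Rightarrow> nat \<Rightarrow> real) measure \<Rightarrow>
    (nat \<Rightarrow> nat \<Rightarrow> real) measure \<Rightarrow> bool" where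
  "graph_induced_law d m G P Pbar \<longleftrightarrow>
     (\<exists>\<kappa> ls. (\<forall>l\<in>{1..d}. cond_law m P l (pa G l) (\<kappa> l)) \<and>
        rev_topological d G ls \<and> Pbar = kernel_prod m G \<kappa> ls)"

text \<open>
  In the following, \<open>xs 1, \<dots>, xs N\<close> are the samples. The radius (and hence the estimator) is
  meaningful for \<open>1 \<le> k < N\<close>; ties are counted with multiplicity.
\<close>

definition knn_radius ::
  "nat \<Rightarrow> (nat \<Rightarrow> nat) \<Rightarrow> nat \<Rightarrow> nat \<Rightarrow> (nat \<Rightarrow> nat \<Rightarrow> nat \<Rightarrow> real) \<Rightarrow> nat \<Rightarrow> real" where
  "knn_radius d m k N xs i =
     sort [linf_dist m {1..d} (xs j) (xs i). j \<leftarrow> [1..<Suc N], j \<noteq> i] ! (k - 1)"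

definition n_within ::
  "nat \<Rightarrow> (nat \<Rightarrow> nat) \<Rightarrow> nat \<Rightarrow> nat \<Rightarrow> (nat \<Rightarrow> nat \<Rightarrow> nat \<Rightarrow> real) \<Rightarrow> nat set \<Rightarrow> nat \<Rightarrow> nat" where
  "n_within d m k N xs S i =
     card {j \<in> {1..N}. j \<noteq> i \<and> linf_dist m S (xs j) (xs i) \<le> knn_radius d m k N xs i}"

definition zeta_stat ::
  "nat \<Rightarrow> (nat \<Rightarrow> nat) \<Rightarrow> (nat \<times> nat) set \<Rightarrow> nat \<Rightarrow> nat \<Rightarrow> (nat \<Rightarrow> nat \<Rightarrow> nat \<Rightarrow> real) \<Rightarrow> nat \<Rightarrow> real" where
  "zeta_stat d m G k N xs i =
     Digamma (real (n_within d m k N xs {1..d} i)) +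
     (\<Sum>l\<in>{1..d}.
        (if pa G l \<noteq> {} then ln (real (n_within d m k N xs (pa G l) i) + 1) else 0) -
        ln (real (n_within d m k N xs (insert l (pa G l)) i) + 1))"

definition gdm_hat ::
  "nat \<Rightarrow> (nat \<Rightarrow> nat) \<Rightarrow> (nat \<times> nat) set \<Rightarrow> nat \<Rightarrow> nat \<Rightarrow> (nat \<Rightarrow> nat \<Rightarrow> nat \<Rightarrow> real) \<Rightarrow> real" where
  "gdm_hat d m G k N xs =
     1 / real N * (\<Sum>i\<in>{1..N}. zeta_stat d m G k N xs i) +
     ((\<Sum>l\<in>{1..d}. if pa G l = {} then 1 else 0) - 1) * ln (real N)"

end

theory Submission
  imports Defs
begin

text \<open>
  The estimator has deterministically bounded differences: changing one of the \<open>N\<close> samples moves it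
  by \<open>O(k log N / N)\<close>, so its variance is \<open>O((k log N)\<^sup>2 / N)\<close> by the Efron--Stein inequality.

  To bound the effect of removing a sample \<open>p\<close>, split the other samples \<open>i\<close> according to the orthant
  around \<open>p\<close> in which they lie. If \<open>p\<close> is in the ball of \<open>i\<close>, then so is every sample of the
  same orthant that is at least as close to \<open>p\<close> as \<open>i\<close> is; hence the number of samples in the ball
  is at least the rank of \<open>i\<close> in its orthant, ordered by the distance to \<open>p\<close>. So at most \<open>k\<close>
  samples per orthant can change their radius, each of which contributes \<open>O(log N)\<close>, and the changes
  at most \<open>1 / rank\<close> of the logarithms for all the others add up to harmonic sums.
\<close>

section \<open>Variance under bounded differences\<close>

text \<open>\<open>f x - expectation f\<close> is the average over \<open>y\<close> of
  \<open>f x - f y\<close>, and each of these differences is at most \<open>c\<close> in absolute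
  value.\<close>

lemma (in prob_space) variance_le_of_bounded_oscillation:
  fixes f :: "'a \<Rightarrow> real"
  assumes f: "integrable M f" "integrable M (\<lambda>x. (f x)\<^sup>2)"
    and osc: "\<And>x y. x \<in> space M \<Longrightarrow> y \<in> space M \<Longrightarrow> \<bar>f x - f y\<bar> \<le> c"
  shows "expectation (\<lambda>x. (f x)\<^sup>2) - (expectation f)\<^sup>2 \<le> c\<^sup>2"
proof -
  have "(f x - expectation f)\<^sup>2 \<le> c\<^sup>2" if x: "x \<in> space M" for x
  proof -
    have "expectation (\<lambda>y. f x - f y) = expectation (\<lambda>_. f x) - expectation f"
      using f by (intro Bochner_Integration.integral_diff) auto
    also have "expectation (\<lambda>_. f x) = f x"
      by (simp add: prob_space)
    finally have "f x - expectation f = expectation (\<lambda>y. f x - f y)" ..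
    also have "\<bar>\<dots>\<bar> \<le> expectation (\<lambda>y. \<bar>f x - f y\<bar>)" by (rule integral_abs_bound)
    also have "\<dots> \<le> expectation (\<lambda>_. c)" using f x by (intro integral_mono osc) auto
    finally have "\<bar>f x - expectation f\<bar> \<le> c" by (simp add: prob_space)
    then have "\<bar>f x - expectation f\<bar>\<^sup>2 \<le> c\<^sup>2" by (intro power_mono) auto
    then show ?thesis by simp
  qed
  moreover have "integrable M (\<lambda>x. (f x - expectation f)\<^sup>2)"
    using f by (simp add: power2_diff)
  ultimately have "variance f \<le> expectation (\<lambda>_. c\<^sup>2)" by (intro integral_mono) auto
  then show ?thesis using variance_eq[OF f] by (simp add: prob_space)
qed

text \<open>Induction on the set of coordinates. Averaging out one coordinate \<open>i\<close> gives
  a function \<open>g\<close> of the others with the same mean and the same bounded differences. By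
  Fubini, its second moment is smaller than that of \<open>f\<close> by at most \<open>c^2\<close>,
  the bound for the variance along a single slice. The bound \<open>B\<close> supplies
  integrability.\<close>

lemma (in product_prob_space) bounded_differences_variance:
  fixes f :: "('i \<Rightarrow> 'a) \<Rightarrow> real"
  assumes "finite J" and "f \<in> borel_measurable (Pi\<^sub>M J M)"
    and "\<And>x. x \<in> space (Pi\<^sub>M J M) \<Longrightarrow> \<bar>f x\<bar> \<le> B"
    and "\<And>i x y. i \<in> J \<Longrightarrow> x \<in> space (Pi\<^sub>M J M) \<Longrightarrow> y \<in> space (M i) \<Longrightarrow> \<bar>f x - f (x(i := y))\<bar> \<le> c"
  shows "(\<integral>x. (f x)\<^sup>2 \<partial>Pi\<^sub>M J M) - (\<integral>x. f x \<partial>Pi\<^sub>M J M)\<^sup>2 \<le> real (card J) * c\<^sup>2"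
  using assms
proof (induction J arbitrary: f rule: finite_induct)
  case empty
  then show ?case by (simp add: PiM_empty lebesgue_integral_count_space_finite)
next
  case (insert i J)
  note [measurable] = insert.prems(1)
  let ?P = "Pi\<^sub>M J M" and ?P' = "Pi\<^sub>M (insert i J) M"
  interpret PJ: prob_space ?P by (intro prob_space_PiM M.prob_space_axioms)
  interpret PI: prob_space ?P' by (intro prob_space_PiM M.prob_space_axioms)
  have upd: "x(i := y) \<in> space ?P'" if "x \<in> space ?P" "y \<in> space (M i)" for x y
    using that by (auto simp: space_PiM PiE_def extensional_def)
  have bound: "\<bar>f (x(i := y))\<bar> \<le> B" if "x \<in> space ?P" "y \<in> space (M i)" for x y
    using insert.prems(2) upd[OF that] .
  have sq_bound: "\<bar>a\<^sup>2\<bar> \<le> B\<^sup>2" if "\<bar>a\<bar> \<le> B" for a :: real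
    using power_mono[OF that, of 2] by simp
  have pair[measurable]: "(\<lambda>(x, y). f (x(i := y))) \<in> borel_measurable (?P \<Otimes>\<^sub>M M i)"
    using measurable_comp[OF measurable_add_dim[of i J M] insert.prems(1)]
    by (simp add: o_def case_prod_beta')
  have slice[measurable]: "(\<lambda>y. f (x(i := y))) \<in> borel_measurable (M i)" if "x \<in> space ?P" for x
    using measurable_Pair2[OF pair that] by simp
  have int_slice: "integrable (M i) (\<lambda>y. f (x(i := y)))" if "x \<in> space ?P" for x
    using that bound by (intro M.integrable_const_bound[where B = B] AE_I2) auto
  have int_slice2: "integrable (M i) (\<lambda>y. (f (x(i := y)))\<^sup>2)" if "x \<in> space ?P" for x
    using that sq_bound[OF bound] by (intro M.integrable_const_bound[where B = "B\<^sup>2"] AE_I2) auto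
  have int: "integrable ?P' f"
    using insert.prems by (intro PI.integrable_const_bound[where B = B] AE_I2) auto
  have int2: "integrable ?P' (\<lambda>x. (f x)\<^sup>2)"
    using sq_bound[OF insert.prems(2)] by (intro PI.integrable_const_bound[where B = "B\<^sup>2"] AE_I2) auto
  define g where "g x = (\<integral>y. f (x(i := y)) \<partial>M i)" for x
  have g_meas[measurable]: "g \<in> borel_measurable ?P"
    unfolding g_def using M.borel_measurable_lebesgue_integral[OF pair] by simp
  have g_bound: "\<bar>g x\<bar> \<le> B" if "x \<in> space ?P" for x
  proof -
    have "\<bar>g x\<bar> \<le> (\<integral>y. \<bar>f (x(i := y))\<bar> \<partial>M i)" unfolding g_def by (rule integral_abs_bound)
    also have "\<dots> \<le> (\<integral>y. B \<partial>M i)"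
      using int_slice[OF that] bound[OF that] by (intro integral_mono) auto
    finally show ?thesis by (simp add: M.prob_space)
  qed
  have g_diff: "\<bar>g x - g (x(j := z))\<bar> \<le> c" if "j \<in> J" "x \<in> space ?P" "z \<in> space (M j)" for j x z
  proof -
    have xz: "x(j := z) \<in> space ?P" using that by (auto simp: space_PiM PiE_def extensional_def)
    have "j \<noteq> i" using that insert.hyps by auto
    \<comment> \<open>The difference of two slice averages is the average of the differences, so
      \<open>g\<close> inherits the constant \<open>c\<close>.\<close>
    have "g x - g (x(j := z)) = (\<integral>y. f (x(i := y)) - f (x(j := z, i := y)) \<partial>M i)"
      unfolding g_def using int_slice[OF that(2)] int_slice[OF xz] by simp
    also have "\<bar>\<dots>\<bar> \<le> (\<integral>y. \<bar>f (x(i := y)) - f (x(j := z, i := y))\<bar> \<partial>M i)"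
      by (rule integral_abs_bound)
    also have "\<dots> \<le> (\<integral>y. c \<partial>M i)"
    proof (rule integral_mono)
      fix y assume "y \<in> space (M i)"
      \<comment> \<open>The updates at \<open>i\<close> and \<open>j\<close> commute, so this is a
        change of coordinate \<open>j\<close> alone at the point \<open>x(i := y)\<close>.\<close>
      then show "\<bar>f (x(i := y)) - f (x(j := z, i := y))\<bar> \<le> c"
        using insert.prems(3)[of j "x(i := y)" z] upd that
          fun_upd_twist[OF \<open>j \<noteq> i\<close>, of x z y] \<open>j \<noteq> i\<close> by (simp del: fun_upd_apply)
    qed (use int_slice[OF that(2)] int_slice[OF xz] in auto)
    finally show ?thesis by (simp add: M.prob_space)
  qed
  have int_g2: "integrable ?P (\<lambda>x. (g x)\<^sup>2)"
    using sq_bound[OF g_bound] by (intro PJ.integrable_const_bound[where B = "B\<^sup>2"] AE_I2) auto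
  \<comment> \<open>Along a slice only coordinate \<open>i\<close> moves, so the oscillation is at
    most \<open>c\<close>, and \<open>g x\<close> is the mean of the slice.\<close>
  have slice_var: "(\<integral>y. (f (x(i := y)))\<^sup>2 \<partial>M i) \<le> (g x)\<^sup>2 + c\<^sup>2" if x: "x \<in> space ?P" for x
  proof -
    have "\<bar>f (x(i := y)) - f (x(i := z))\<bar> \<le> c" if "y \<in> space (M i)" "z \<in> space (M i)" for y z
      using insert.prems(3)[of i "x(i := y)" z] upd[OF x] that by (simp del: fun_upd_apply)
    then show ?thesis
      using M.variance_le_of_bounded_oscillation[OF int_slice[OF x] int_slice2[OF x], of c]
      unfolding g_def by simp
  qed
  have "(\<integral>x. (f x)\<^sup>2 \<partial>?P') = (\<integral>x. (\<integral>y. (f (x(i := y)))\<^sup>2 \<partial>M i) \<partial>?P)"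
    using insert.hyps int2 by (rule product_integral_insert)
  also have "\<dots> \<le> (\<integral>x. (g x)\<^sup>2 + c\<^sup>2 \<partial>?P)"
  proof (rule integral_mono)
    have "(\<lambda>x. \<integral>y. (f (x(i := y)))\<^sup>2 \<partial>M i) \<in> borel_measurable ?P"
      using M.borel_measurable_lebesgue_integral[of "\<lambda>x y. (f (x(i := y)))\<^sup>2" ?P i] pair
      by (simp add: case_prod_beta')
    moreover have "\<bar>\<integral>y. (f (x(i := y)))\<^sup>2 \<partial>M i\<bar> \<le> B\<^sup>2" if "x \<in> space ?P" for x
    proof -
      have "(\<integral>y. (f (x(i := y)))\<^sup>2 \<partial>M i) \<le> (\<integral>y. B\<^sup>2 \<partial>M i)"
        using int_slice2[OF that] sq_bound[OF bound[OF that]] by (intro integral_mono) auto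
      then show ?thesis by (simp add: M.prob_space)
    qed
    ultimately show "integrable ?P (\<lambda>x. \<integral>y. (f (x(i := y)))\<^sup>2 \<partial>M i)"
      by (intro PJ.integrable_const_bound[where B = "B\<^sup>2"] AE_I2) auto
  qed (use int_g2 slice_var in auto)
  also have "\<dots> = (\<integral>x. (g x)\<^sup>2 \<partial>?P) + c\<^sup>2"
    using int_g2 by (simp add: PJ.prob_space)
  finally have "(\<integral>x. (f x)\<^sup>2 \<partial>?P') \<le> (\<integral>x. (g x)\<^sup>2 \<partial>?P) + c\<^sup>2" .
  moreover have "(\<integral>x. f x \<partial>?P') = (\<integral>x. g x \<partial>?P)"
    unfolding g_def using insert.hyps int by (rule product_integral_insert)
  moreover have "(\<integral>x. (g x)\<^sup>2 \<partial>?P) - (\<integral>x. g x \<partial>?P)\<^sup>2 \<le> real (card J) * c\<^sup>2"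
    by (rule insert.IH[OF g_meas g_bound g_diff])
  ultimately show ?case using insert.hyps by (simp add: algebra_simps)
qed

section \<open>Digamma and logarithm at natural numbers\<close>

text \<open>The difference of \<open>harm n\<close> and \<open>ln n\<close> decreases in
  \<open>n\<close> and equals 1 at \<open>n = 1\<close>.\<close>

lemma harm_le_1_plus_ln:
  assumes "0 < n"
  shows "(harm n :: real) \<le> 1 + ln (real n)"
  using euler_mascheroni_sequence_decreasing[of 1 n] assms by (simp add: harm_def)

text \<open>At \<open>q + 1\<close> the function \<open>Digamma\<close> is \<open>harm q\<close>
  minus the Euler-Mascheroni constant, which lies between 0 and 1.\<close>

lemma abs_Digamma_nat_le:
  assumes "0 < n" "n \<le> N"
  shows "\<bar>Digamma (real n)\<bar> \<le> 1 + ln (real N)"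
proof -
  obtain q where n: "n = Suc q" using assms by (cases n) auto
  have D: "Digamma (real n) = harm q - euler_mascheroni"
    unfolding n by (rule Digamma_of_nat)
  have "harm q \<le> 1 + ln (real N)"
  proof (cases "q = 0")
    case True
    then show ?thesis using assms by (simp add: harm_def)
  next
    case False
    have "ln (real q) \<le> ln (real N)" using False assms n by simp
    then show ?thesis using harm_le_1_plus_ln[of q] False by simp
  qed
  moreover have "harm q \<ge> (0::real)" by (rule harm_nonneg)
  moreover have "ln (real N) \<ge> 0" using assms by simp
  moreover have "0 < (euler_mascheroni::real)" "(euler_mascheroni::real) < 1"
    using euler_mascheroni_pos euler_mascheroni_less_13_over_22 by simp_all
  ultimately show ?thesis unfolding D by linarith
qed

lemma ln_Suc_diff_le:
  assumes "0 < n"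
  shows "\<bar>ln (real (n + 1)) - ln (real n)\<bar> \<le> 1 / real n"
proof -
  have "ln (1 + 1 / real n) \<le> 1 / real n" by (rule ln_add_one_self_le_self) simp
  moreover have "ln (1 + 1 / real n) = ln (real (n + 1)) - ln (real n)"
  proof -
    have "1 + 1 / real n = real (n + 1) / real n" using assms by (simp add: field_simps)
    then show ?thesis using assms by (simp add: ln_div)
  qed
  moreover have "ln (real n) \<le> ln (real (n + 1))" using assms by simp
  ultimately show ?thesis by linarith
qed

section \<open>Ranks\<close>

text \<open>Without ties the ranks are 1 up to \<open>card A\<close> and equality holds; ties only
  raise ranks. The induction adds the elements in increasing order of \<open>f\<close>, so each new
  element has the full cardinality as its rank.\<close>

lemma sum_inverse_rank_le_harm:
  fixes f :: "'a \<Rightarrow> real"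
  assumes "finite A"
  shows "(\<Sum>i\<in>A. 1 / real (card {j\<in>A. f j \<le> f i})) \<le> harm (card A)"
  using assms
proof (induction A rule: finite_ranking_induct[where f = f])
  case (insert x S)
  show ?case
  proof (cases "x \<in> S")
    case True
    then show ?thesis using insert by (simp add: insert_absorb)
  next
    case False
    have "{j \<in> insert x S. f j \<le> f x} = insert x S" using insert by auto
    \<comment> \<open>The rank of an earlier element stays the same, or grows by one if
      \<open>x\<close> ties with it.\<close>
    moreover have "1 / real (card {j\<in>insert x S. f j \<le> f i})
        \<le> 1 / real (card {j\<in>S. f j \<le> f i})" if "i \<in> S" for i
    proof -
      have "card {j\<in>S. f j \<le> f i} > 0"
        using that insert.hyps(1) by (subst card_gt_0_iff) auto
      moreover have "card {j\<in>S. f j \<le> f i} \<le> card {j\<in>insert x S. f j \<le> f i}"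
        using insert.hyps(1) by (intro card_mono) auto
      ultimately show ?thesis by (intro divide_left_mono) auto
    qed
    then have "(\<Sum>i\<in>S. 1 / real (card {j\<in>insert x S. f j \<le> f i})) \<le> harm (card S)"
      using insert.IH by (meson order_trans sum_mono)
    ultimately show ?thesis
      using False insert.hyps(1) by (simp add: harm_Suc divide_inverse)
  qed
qed (simp add: harm_def)

text \<open>The rank of an element of \<open>?B\<close> with the largest value of \<open>f\<close>
  counts all of \<open>?B\<close>, and this rank is at most \<open>k\<close>.\<close>

lemma card_rank_le:
  fixes f :: "'a \<Rightarrow> real"
  assumes "finite A"
  shows "card {i\<in>A. card {j\<in>A. f j \<le> f i} \<le> k} \<le> k" (is "card ?B \<le> k")
proof (cases "?B = {}")
  case True
  then show ?thesis by (simp only: card.empty)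
next
  case False
  have fin: "finite ?B" using assms by simp
  have "Max (f ` ?B) \<in> f ` ?B" using fin False by (intro Max_in) auto
  then obtain i where "i \<in> ?B" "f i = Max (f ` ?B)" by auto
  then have i: "i \<in> ?B" "\<And>j. j \<in> ?B \<Longrightarrow> f j \<le> f i"
    using fin by auto
  have "card ?B \<le> card {j\<in>A. f j \<le> f i}"
    using assms i(2) by (intro card_mono) auto
  also have "\<dots> \<le> k" using i(1) by simp
  finally show ?thesis .
qed

text \<open>Within each of the at most \<open>Q\<close> classes of \<open>c\<close>, the numbers
  \<open>g i\<close> dominate ranks, so each class contributes at most a harmonic sum. The classes
  will be orthants and \<open>g\<close> will be ball counts.\<close>

lemma sum_inverse_classwise_rank_le:
  fixes f :: "'a \<Rightarrow> real" and c :: "'a \<Rightarrow> 'c"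
  assumes A: "finite A" and Q: "card (c ` A) \<le> Q" and N: "card A \<le> N" "0 < N"
    and g: "\<And>i. i \<in> A \<Longrightarrow> card {j\<in>A. c j = c i \<and> f j \<le> f i} \<le> g i"
  shows "(\<Sum>i\<in>A. 1 / real (g i)) \<le> real Q * (1 + ln (real N))"
proof -
  have "(\<Sum>i | i \<in> A \<and> c i = y. 1 / real (g i)) \<le> 1 + ln (real N)" if "y \<in> c ` A" for y
  proof -
    let ?A = "{i\<in>A. c i = y}"
    have "(\<Sum>i\<in>?A. 1 / real (g i)) \<le> (\<Sum>i\<in>?A. 1 / real (card {j\<in>?A. f j \<le> f i}))"
    proof (rule sum_mono)
      fix i assume i: "i \<in> ?A"
      then have "0 < card {j\<in>?A. f j \<le> f i}" using A by (subst card_gt_0_iff) auto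
      moreover have "card {j\<in>?A. f j \<le> f i} \<le> g i" using g[of i] i by (simp add: conj_ac)
      ultimately show "1 / real (g i) \<le> 1 / real (card {j\<in>?A. f j \<le> f i})"
        by (intro divide_left_mono) auto
    qed
    also have "\<dots> \<le> harm (card ?A)" using A by (intro sum_inverse_rank_le_harm) simp
    also have "\<dots> \<le> 1 + ln (real (card ?A))"
      using that A by (intro harm_le_1_plus_ln) (auto simp: card_gt_0_iff)
    also have "\<dots> \<le> 1 + ln (real N)"
    proof -
      have "0 < card ?A" using that A by (auto simp: card_gt_0_iff)
      moreover have "card ?A \<le> card A" using A by (intro card_mono) auto
      ultimately show ?thesis using N(1) by simp
    qed
    finally show ?thesis .
  qed
  then have "(\<Sum>y\<in>c ` A. \<Sum>i | i \<in> A \<and> c i = y. 1 / real (g i))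
      \<le> real (card (c ` A)) * (1 + ln (real N))"
    by (rule sum_bounded_above)
  also have "\<dots> \<le> real Q * (1 + ln (real N))"
    using Q N by (intro mult_right_mono) auto
  finally show ?thesis by (subst sum.image_gen[OF A, of _ c])
qed

text \<open>Since \<open>g i\<close> dominates the rank of \<open>i\<close> in its class, each class
  has at most \<open>k\<close> elements with \<open>g i \<le> k\<close>.\<close>

lemma card_classwise_rank_le:
  fixes f :: "'a \<Rightarrow> real" and c :: "'a \<Rightarrow> 'c"
  assumes A: "finite A" and Q: "card (c ` A) \<le> Q"
    and g: "\<And>i. i \<in> A \<Longrightarrow> card {j\<in>A. c j = c i \<and> f j \<le> f i} \<le> g i"
  shows "card {i\<in>A. g i \<le> k} \<le> Q * k"
proof -
  have "{i\<in>A. g i \<le> k} = (\<Union>y\<in>c ` A. {i\<in>A. c i = y \<and> g i \<le> k})" by auto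
  then have "card {i\<in>A. g i \<le> k} \<le> (\<Sum>y\<in>c ` A. card {i\<in>A. c i = y \<and> g i \<le> k})"
    using A by (simp only:) (intro card_UN_le finite_imageI)
  also have "\<dots> \<le> (\<Sum>y\<in>c ` A. k)"
  proof (rule sum_mono)
    fix y assume "y \<in> c ` A"
    let ?A = "{i\<in>A. c i = y}"
    have "card {i\<in>A. c i = y \<and> g i \<le> k} \<le> card {i\<in>?A. card {j\<in>?A. f j \<le> f i} \<le> k}"
    proof (intro card_mono subsetI)
      fix i assume i: "i \<in> {i\<in>A. c i = y \<and> g i \<le> k}"
      have "{j\<in>?A. f j \<le> f i} = {j\<in>A. c j = c i \<and> f j \<le> f i}" using i by auto
      then show "i \<in> {i\<in>?A. card {j\<in>?A. f j \<le> f i} \<le> k}"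
        using g[of i] i by simp
    qed (use A in simp)
    also have "\<dots> \<le> k" using A by (intro card_rank_le) simp
    finally show "card {i\<in>A. c i = y \<and> g i \<le> k} \<le> k" .
  qed
  also have "\<dots> \<le> Q * k" using Q by simp
  finally show ?thesis .
qed

section \<open>Nearest neighbours\<close>

text \<open>In a sorted list the entries at most \<open>r\<close> form an initial segment, and
  sorting does not change their number. This trades an order statistic for a count.\<close>

lemma sort_nth_le_iff:
  fixes xs :: "'a::linorder list"
  assumes "n < length xs"
  shows "sort xs ! n \<le> r \<longleftrightarrow> n < length (filter (\<lambda>x. x \<le> r) xs)"
proof -
  have *: "ys ! n \<le> r \<longleftrightarrow> n < length (filter (\<lambda>x. x \<le> r) ys)"
    if "sorted ys" "n < length ys" for ys and n
    using that
  proof (induction ys arbitrary: n)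
    case (Cons a zs)
    show ?case
    proof (cases "a \<le> r")
      case True
      then show ?thesis using Cons by (cases n) auto
    next
      case False
      then have "\<And>z. z \<in> set (a # zs) \<Longrightarrow> \<not> z \<le> r" using Cons.prems(1) by force
      then have "filter (\<lambda>x. x \<le> r) (a # zs) = []" "\<not> (a # zs) ! n \<le> r"
        using nth_mem[OF Cons.prems(2)] by (auto simp: filter_empty_conv)
      then show ?thesis by simp
    qed
  qed simp
  have "length (filter (\<lambda>x. x \<le> r) (sort xs)) = length (filter (\<lambda>x. x \<le> r) xs)"
    by (metis filter_sort length_sort)
  then show ?thesis using *[of "sort xs" n] assms by simp
qed

definition nbrs :: "('i \<Rightarrow> 'i \<Rightarrow> real) \<Rightarrow> 'i set \<Rightarrow> real \<Rightarrow> 'i \<Rightarrow> 'i set" where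
  "nbrs D J r i = {j\<in>J. j \<noteq> i \<and> D j i \<le> r}"

text \<open>The index set \<open>J\<close> is arbitrary so that a sample can be removed;
  \<open>D\<close> is any function of two indices. The position is \<open>k - 1\<close> because
  lists are indexed from 0.\<close>

definition kth_radius :: "nat \<Rightarrow> ('i::linorder \<Rightarrow> 'i \<Rightarrow> real) \<Rightarrow> 'i set \<Rightarrow> 'i \<Rightarrow> real" where
  "kth_radius k D J i = sort [D j i. j \<leftarrow> sorted_list_of_set J, j \<noteq> i] ! (k - 1)"

text \<open>This equivalence characterizes the radius. Sorting is not looked at again for its size:
  removal of samples, lower bounds on counts and measurability all go through it.\<close>

lemma kth_radius_le_iff:
  assumes "finite J" "1 \<le> k" "k \<le> card (J - {i})"
  shows "kth_radius k D J i \<le> r \<longleftrightarrow> k \<le> card (nbrs D J r i)"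
proof -
  let ?js = "filter (\<lambda>j. j \<noteq> i) (sorted_list_of_set J)"
  have list: "[D j i. j \<leftarrow> js, j \<noteq> i] = map (\<lambda>j. D j i) (filter (\<lambda>j. j \<noteq> i) js)" for js
    by (induction js) simp_all
  have len: "length (filter P (sorted_list_of_set J)) = card {j\<in>J. P j}" for P
  proof -
    have "length (filter P (sorted_list_of_set J)) = card (set (filter P (sorted_list_of_set J)))"
      by (intro distinct_card[symmetric] distinct_filter distinct_sorted_list_of_set)
    then show ?thesis using assms(1) by simp
  qed
  have "length ?js = card {j\<in>J. j \<noteq> i}" by (rule len)
  also have "{j\<in>J. j \<noteq> i} = J - {i}" by auto
  finally have "k - 1 < length (map (\<lambda>j. D j i) ?js)" using assms by simp
  then have "kth_radius k D J i \<le> r \<longleftrightarrow> k - 1 < length (filter (\<lambda>x. x \<le> r) (map (\<lambda>j. D j i) ?js))"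
    unfolding kth_radius_def list by (rule sort_nth_le_iff)
  also have "length (filter (\<lambda>x. x \<le> r) (map (\<lambda>j. D j i) ?js))
      = length (filter (\<lambda>j. j \<noteq> i \<and> D j i \<le> r) (sorted_list_of_set J))"
    by (simp add: filter_map o_def conj_commute)
  also have "\<dots> = card (nbrs D J r i)"
    unfolding nbrs_def by (rule len)
  finally show ?thesis using assms(2) by auto
qed

lemma nbrs_mono: "(\<And>j. D j i \<le> r \<Longrightarrow> E j i \<le> r) \<Longrightarrow> nbrs D J r i \<subseteq> nbrs E J r i"
  unfolding nbrs_def by auto

lemma finite_nbrs: "finite J \<Longrightarrow> finite (nbrs D J r i)"
  unfolding nbrs_def by simp

lemma card_nbrs_remove:
  assumes "finite J" "p \<in> J" "i \<noteq> p"
  shows "card (nbrs D J r i) = card (nbrs D (J - {p}) r i) + (if D p i \<le> r then 1 else 0)"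
proof (cases "D p i \<le> r")
  case True
  then have "nbrs D J r i = insert p (nbrs D (J - {p}) r i)"
    using assms unfolding nbrs_def by auto
  moreover have "p \<notin> nbrs D (J - {p}) r i" unfolding nbrs_def by simp
  ultimately show ?thesis using True assms by (simp add: finite_nbrs)
next
  case False
  then have "nbrs D J r i = nbrs D (J - {p}) r i"
    using assms unfolding nbrs_def by auto
  then show ?thesis using False by simp
qed

text \<open>
  Ties are harmless here: removing \<open>p\<close> can only change the radius of \<open>i\<close> if the closed ball
  around \<open>i\<close> contains \<open>p\<close> and exactly \<open>k\<close> points in total.
\<close>

lemma kth_radius_remove:
  assumes J: "finite J" "p \<in> J" "i \<noteq> p" and k: "1 \<le> k" "k \<le> card (J - {p} - {i})"
    and not_critical: "\<not> (D p i \<le> kth_radius k D J i \<and> card (nbrs D J (kth_radius k D J i) i) \<le> k)"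
  shows "kth_radius k D (J - {p}) i = kth_radius k D J i"
proof (rule antisym)
  have "card (J - {p} - {i}) \<le> card (J - {i})" using J(1) by (intro card_mono) auto
  then have k': "k \<le> card (J - {i})" using k(2) by simp
  have iff: "kth_radius k D J i \<le> r \<longleftrightarrow> k \<le> card (nbrs D J r i)" for r
    using J k k' by (intro kth_radius_le_iff)
  have iff': "kth_radius k D (J - {p}) i \<le> r \<longleftrightarrow> k \<le> card (nbrs D (J - {p}) r i)" for r
    using J k by (intro kth_radius_le_iff) auto
  \<comment> \<open>The old ball still holds \<open>k\<close> samples after the removal: if it
    contained \<open>p\<close>, it contained more than \<open>k\<close>. The converse inequality
    holds because removal never adds samples to a ball.\<close>
  show "kth_radius k D (J - {p}) i \<le> kth_radius k D J i"
    using not_critical iff[of "kth_radius k D J i"] card_nbrs_remove[OF J, of D "kth_radius k D J i"]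
    unfolding iff' by (auto split: if_splits)
  show "kth_radius k D J i \<le> kth_radius k D (J - {p}) i"
    using iff'[of "kth_radius k D (J - {p}) i"]
      card_nbrs_remove[OF J, of D "kth_radius k D (J - {p}) i"]
    unfolding iff by auto
qed

text \<open>A class member \<open>j\<close> no farther from \<open>p\<close> than \<open>i\<close>
  satisfies \<open>D j i \<le> D p i \<le> r i\<close>, so it lies in the ball of \<open>i\<close>.
  The assumption \<open>cone\<close> isolates the one geometric property required of the classes;
  \<open>r\<close> need not be derived from \<open>D\<close>, so \<open>D\<close> can be the
  distance in a sub-collection of the components.\<close>

lemma card_class_le_card_nbrs:
  assumes J: "finite J" "p \<in> J" and A: "A \<subseteq> {i\<in>J. i \<noteq> p \<and> D p i \<le> r i}"
    and cone: "\<And>i j. c j = c i \<Longrightarrow> D j p \<le> D i p \<Longrightarrow> D j i \<le> D p i"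
    and i: "i \<in> A"
  shows "card {j\<in>A. c j = c i \<and> D j p \<le> D i p} \<le> card (nbrs D J (r i) i)"
proof -
  let ?C = "{j\<in>A. c j = c i \<and> D j p \<le> D i p}"
  have fin: "finite ?C" using A J(1) by (auto intro: finite_subset)
  \<comment> \<open>The index \<open>i\<close> is in its class but is not its own neighbour;
    \<open>p\<close>, which is outside \<open>A\<close> but in the ball of \<open>i\<close>, takes
    its place.\<close>
  have "card ?C = Suc (card (?C - {i}))"
    using fin i by (subst card.remove[of _ i]) auto
  also have "\<dots> = card (insert p (?C - {i}))"
    using A fin by (subst card_insert_disjoint) auto
  also have "\<dots> \<le> card (nbrs D J (r i) i)"
    using A J i cone[of _ i] unfolding nbrs_def
    by (intro card_mono) (auto intro: order_trans)
  finally show ?thesis .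
qed

section \<open>Orthants\<close>

lemma finite_coords:
  assumes "finite S"
  shows "finite {\<bar>x l j - y l j\<bar> | l j. l \<in> S \<and> j < (m l :: nat)}"
proof -
  have "{\<bar>x l j - y l j\<bar> | l j. l \<in> S \<and> j < m l}
      = (\<lambda>(l, j). \<bar>x l j - y l j\<bar>) ` (SIGMA l:S. {..<m l})" by auto
  then show ?thesis using assms by simp
qed

lemma linf_dist_le_iff:
  assumes "finite S"
  shows "linf_dist m S x y \<le> r \<longleftrightarrow> 0 \<le> r \<and> (\<forall>l\<in>S. \<forall>j<m l. \<bar>x l j - y l j\<bar> \<le> r)"
  unfolding linf_dist_def using finite_coords[OF assms, of x y m]
  by (subst Max_le_iff) auto

lemma linf_dist_commute: "linf_dist m S x y = linf_dist m S y x"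
  unfolding linf_dist_def by (simp add: abs_minus_commute)

lemma linf_dist_mono:
  assumes "finite T" "S \<subseteq> T" "linf_dist m T x y \<le> r"
  shows "linf_dist m S x y \<le> r"
  using assms finite_subset[OF assms(2,1)] by (auto simp: linf_dist_le_iff)

text \<open>The orthant with apex \<open>x\<close> that contains \<open>y\<close>, encoded by its
  sign pattern. Ties count as positive, so every \<open>y\<close> belongs to exactly one
  orthant.\<close>

definition orthant :: "(nat \<Rightarrow> nat) \<Rightarrow> nat set \<Rightarrow> (nat \<Rightarrow> nat \<Rightarrow> real) \<Rightarrow> (nat \<Rightarrow> nat \<Rightarrow> real) \<Rightarrow> (nat \<times> nat) set"
  where "orthant m T x y = {(l, j). l \<in> T \<and> j < m l \<and> x l j \<le> y l j}"

definition n_orthants :: "(nat \<Rightarrow> nat) \<Rightarrow> nat set \<Rightarrow> nat" where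
  "n_orthants m T = 2 ^ card (SIGMA l:T. {..<m l})"

lemma card_orthants_le:
  assumes "finite T"
  shows "card (orthant m T x ` A) \<le> n_orthants m T"
proof -
  have "orthant m T x ` A \<subseteq> Pow (SIGMA l:T. {..<m l})"
    unfolding orthant_def by auto
  then have "card (orthant m T x ` A) \<le> card (Pow (SIGMA l:T. {..<m l}))"
    using assms by (intro card_mono) auto
  then show ?thesis using assms unfolding n_orthants_def by (simp add: card_Pow)
qed

text \<open>
  This is special to the \<open>\<ell>\<^sub>\<infinity>\<close> distance, which lets orthants play the role of the narrow cones
  of the Euclidean argument.
\<close>

lemma linf_dist_same_orthant:
  assumes T: "finite T" "S \<subseteq> T" and eq: "orthant m T p y = orthant m T p z"
    and le: "linf_dist m S y p \<le> linf_dist m S z p"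
  shows "linf_dist m S y z \<le> linf_dist m S p z"
proof -
  define r where "r = linf_dist m S p z"
  have S: "finite S" using T finite_subset by blast
  have y: "0 \<le> r" "l \<in> S \<Longrightarrow> j < m l \<Longrightarrow> \<bar>y l j - p l j\<bar> \<le> r" for l j
    using le linf_dist_le_iff[OF S, of m y p r] unfolding r_def linf_dist_commute[of m S p z] by auto
  have z: "l \<in> S \<Longrightarrow> j < m l \<Longrightarrow> \<bar>p l j - z l j\<bar> \<le> r" for l j
    using linf_dist_le_iff[OF S, of m p z r] unfolding r_def by auto
  have "\<bar>y l j - z l j\<bar> \<le> r" if "l \<in> S" "j < m l" for l j
  proof -
    \<comment> \<open>In each coordinate \<open>y\<close> and \<open>z\<close> are on the same side
      of \<open>p\<close>, so their difference is at most the larger of their differences from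
      \<open>p\<close>.\<close>
    have "(l, j) \<in> orthant m T p y \<longleftrightarrow> (l, j) \<in> orthant m T p z" using eq by simp
    then have "p l j \<le> y l j \<longleftrightarrow> p l j \<le> z l j" using that T(2) unfolding orthant_def by auto
    then show ?thesis using y(2)[OF that] z[OF that] by linarith
  qed
  then show ?thesis using y(1) S unfolding r_def[symmetric] by (simp add: linf_dist_le_iff)
qed

section \<open>Effect of removing a sample\<close>

abbreviation pdist :: "(nat \<Rightarrow> nat) \<Rightarrow> nat set \<Rightarrow> (nat \<Rightarrow> nat \<Rightarrow> nat \<Rightarrow> real) \<Rightarrow> nat \<Rightarrow> nat \<Rightarrow> real" where
  "pdist m S xs \<equiv> \<lambda>i j. linf_dist m S (xs i) (xs j)"

text \<open>The count \<open>n_within\<close> for samples indexed by \<open>J\<close>: the radius is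
  measured in \<open>T\<close>, the neighbours are counted in \<open>S\<close>.\<close>

definition ball_count ::
  "(nat \<Rightarrow> nat) \<Rightarrow> nat set \<Rightarrow> nat \<Rightarrow> (nat \<Rightarrow> nat \<Rightarrow> nat \<Rightarrow> real) \<Rightarrow> nat set \<Rightarrow> nat set \<Rightarrow> nat \<Rightarrow> nat" where
  "ball_count m T k xs S J i = card (nbrs (pdist m S xs) J (kth_radius k (pdist m T xs) J i) i)"

text \<open>For \<open>J = {1..N}\<close> this is \<open>zeta_stat\<close>. With
  \<open>J - {p}\<close> both the radius and the counts are recomputed without the sample
  \<open>p\<close>.\<close>

definition zeta_on ::
  "nat \<Rightarrow> (nat \<Rightarrow> nat) \<Rightarrow> (nat \<times> nat) set \<Rightarrow> nat \<Rightarrow> nat set \<Rightarrow> (nat \<Rightarrow> nat \<Rightarrow> nat \<Rightarrow> real) \<Rightarrow> nat \<Rightarrow> real" where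
  "zeta_on d m G k J xs i =
     Digamma (real (ball_count m {1..d} k xs {1..d} J i)) +
     (\<Sum>l\<in>{1..d}.
        (if pa G l \<noteq> {} then ln (real (ball_count m {1..d} k xs (pa G l) J i) + 1) else 0) -
        ln (real (ball_count m {1..d} k xs (insert l (pa G l)) J i) + 1))"

lemma knn_radius_eq: "knn_radius d m k N xs i = kth_radius k (pdist m {1..d} xs) {1..N} i"
proof -
  have "sorted_list_of_set {1..N} = [1..<Suc N]"
    by (metis atLeastLessThanSuc_atLeastAtMost sorted_list_of_set_range)
  then show ?thesis unfolding knn_radius_def kth_radius_def by simp
qed

lemma zeta_stat_eq: "zeta_stat d m G k N xs i = zeta_on d m G k {1..N} xs i"
  unfolding zeta_stat_def zeta_on_def n_within_def ball_count_def nbrs_def knn_radius_eq ..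

text \<open>Used to see that replacing the sample \<open>p\<close> does not affect the statistics
  formed without it.\<close>

lemma zeta_on_cong:
  assumes J: "finite J" and eq: "\<And>j. j \<in> J \<Longrightarrow> xs j = ys j" and i: "i \<in> J"
  shows "zeta_on d m G k J xs i = zeta_on d m G k J ys i"
proof -
  have "kth_radius k (pdist m T xs) J i = kth_radius k (pdist m T ys) J i" for T
  proof -
    have "map (\<lambda>j. if j \<noteq> i then [pdist m T xs j i] else []) (sorted_list_of_set J)
        = map (\<lambda>j. if j \<noteq> i then [pdist m T ys j i] else []) (sorted_list_of_set J)"
      using J eq i by (intro map_cong) auto
    then show ?thesis
      unfolding kth_radius_def by (rule arg_cong[where f = "\<lambda>ls. sort (concat ls) ! (k - 1)"])
  qed
  moreover have "nbrs (pdist m S xs) J r i = nbrs (pdist m S ys) J r i" for S r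
    unfolding nbrs_def using eq i by auto
  ultimately show ?thesis unfolding zeta_on_def ball_count_def by (simp only:)
qed

section \<open>Ball counts and the removal of a sample\<close>

context
  fixes m :: "nat \<Rightarrow> nat" and T :: "nat set" and k :: nat and xs :: "nat \<Rightarrow> nat \<Rightarrow> nat \<Rightarrow> real"
    and J :: "nat set"
  assumes T: "finite T" and J: "finite J" and k: "1 \<le> k"
begin

text \<open>The ball in \<open>T\<close> holds at least \<open>k\<close> samples, and passing to
  fewer coordinates only shortens distances; \<open>i\<close> itself is never counted. With
  \<open>1 \<le> k\<close> this keeps \<open>Digamma\<close> away from its pole at 0.\<close>

lemma ball_count_bounds:
  assumes "S \<subseteq> T" "i \<in> J" "k < card J"
  shows "k \<le> ball_count m T k xs S J i" "ball_count m T k xs S J i < card J"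
proof -
  let ?r = "kth_radius k (pdist m T xs) J i"
  have "k \<le> card (J - {i})" using assms J by simp
  then have "k \<le> card (nbrs (pdist m T xs) J ?r i)"
    using kth_radius_le_iff[OF J k, of i "pdist m T xs" ?r] by simp
  also have "\<dots> \<le> ball_count m T k xs S J i"
    unfolding ball_count_def
    by (intro card_mono finite_nbrs J nbrs_mono linf_dist_mono[OF T assms(1)])
  finally show "k \<le> ball_count m T k xs S J i" .
  have "nbrs (pdist m S xs) J ?r i \<subset> J" using assms(2) unfolding nbrs_def by auto
  then show "ball_count m T k xs S J i < card J"
    unfolding ball_count_def by (intro psubset_card_mono J)
qed

text \<open>Among the samples whose ball in \<open>S\<close> contains \<open>p\<close>, the count of
  \<open>i\<close> is at least its rank by distance to \<open>p\<close> within its orthant. Orthants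
  are taken in all of \<open>T\<close>, which fixes the signs in every \<open>S\<close> at
  once.\<close>

lemma sum_inverse_ball_count_le:
  assumes S: "S \<subseteq> T" and p: "p \<in> J"
  shows "(\<Sum>i\<in>J - {p}. if pdist m S xs p i \<le> kth_radius k (pdist m T xs) J i
             then 1 / real (ball_count m T k xs S J i) else 0)
         \<le> real (n_orthants m T) * (1 + ln (real (card J)))"
proof -
  let ?A = "{i\<in>J - {p}. pdist m S xs p i \<le> kth_radius k (pdist m T xs) J i}"
  have "(\<Sum>i\<in>?A. 1 / real (ball_count m T k xs S J i))
      \<le> real (n_orthants m T) * (1 + ln (real (card J)))"
  proof (rule sum_inverse_classwise_rank_le[where c = "\<lambda>i. orthant m T (xs p) (xs i)"
        and f = "\<lambda>i. pdist m S xs i p"])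
    show "card ((\<lambda>i. orthant m T (xs p) (xs i)) ` ?A) \<le> n_orthants m T"
      using card_orthants_le[OF T, of m "xs p" "xs ` ?A"] by (simp add: image_image)
    show "card ?A \<le> card J" "finite ?A" "0 < card J"
      using J p by (auto intro: card_mono simp: card_gt_0_iff)
    show "card {j \<in> ?A. orthant m T (xs p) (xs j) = orthant m T (xs p) (xs i) \<and>
        pdist m S xs j p \<le> pdist m S xs i p} \<le> ball_count m T k xs S J i" if "i \<in> ?A" for i
      unfolding ball_count_def
      by (rule card_class_le_card_nbrs[OF J p _ _ that])
         (auto intro: linf_dist_same_orthant[OF T S])
  qed
  then show ?thesis using J by (simp add: sum.If_cases Int_def)
qed

text \<open>These are the samples whose radius may change when \<open>p\<close> leaves. Their counts
  are at most \<open>k\<close>, hence so are their ranks, which leaves at most \<open>k\<close> of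
  them per orthant.\<close>

lemma card_critical_le:
  assumes p: "p \<in> J"
  shows "card {i\<in>J - {p}. pdist m T xs p i \<le> kth_radius k (pdist m T xs) J i \<and>
      ball_count m T k xs T J i \<le> k} \<le> n_orthants m T * k"
proof -
  let ?A = "{i\<in>J - {p}. pdist m T xs p i \<le> kth_radius k (pdist m T xs) J i}"
  have "card {i\<in>?A. ball_count m T k xs T J i \<le> k} \<le> n_orthants m T * k"
  proof (rule card_classwise_rank_le[where c = "\<lambda>i. orthant m T (xs p) (xs i)"
        and f = "\<lambda>i. pdist m T xs i p"])
    show "card ((\<lambda>i. orthant m T (xs p) (xs i)) ` ?A) \<le> n_orthants m T"
      using card_orthants_le[OF T, of m "xs p" "xs ` ?A"] by (simp add: image_image)
    show "finite ?A" using J by simp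
    show "card {j \<in> ?A. orthant m T (xs p) (xs j) = orthant m T (xs p) (xs i) \<and>
        pdist m T xs j p \<le> pdist m T xs i p} \<le> ball_count m T k xs T J i" if "i \<in> ?A" for i
      unfolding ball_count_def
      by (rule card_class_le_card_nbrs[OF J p _ _ that])
         (auto intro: linf_dist_same_orthant[OF T order_refl])
  qed
  then show ?thesis by (simp add: conj_ac)
qed

lemma ball_count_remove:
  assumes p: "p \<in> J" "i \<in> J" "i \<noteq> p" and card: "k + 2 \<le> card J"
    and not_critical: "\<not> (pdist m T xs p i \<le> kth_radius k (pdist m T xs) J i \<and>
      ball_count m T k xs T J i \<le> k)"
  shows "ball_count m T k xs S J i = ball_count m T k xs S (J - {p}) i +
    (if pdist m S xs p i \<le> kth_radius k (pdist m T xs) J i then 1 else 0)"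
proof -
  \<comment> \<open>Both \<open>p\<close> and \<open>i\<close> are excluded from the candidates,
    hence the assumption \<open>k + 2 \<le> card J\<close>.\<close>
  have "k \<le> card (J - {p} - {i})" using p J card by simp
  then have "kth_radius k (pdist m T xs) (J - {p}) i = kth_radius k (pdist m T xs) J i"
    using not_critical p J k unfolding ball_count_def by (intro kth_radius_remove) auto
  then show ?thesis
    unfolding ball_count_def using card_nbrs_remove[OF J p(1,3)] by simp
qed

end

section \<open>Change of the local statistics and of their sum\<close>

lemma pa_subset: "is_dag d G \<Longrightarrow> pa G l \<subseteq> {1..d}"
  unfolding is_dag_def pa_def by auto

text \<open>Every count lies strictly between 0 and \<open>N\<close>, so each of the
  \<open>2 * d + 1\<close> terms is at most \<open>1 + ln N\<close>. This crude bound serves for the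
  critical samples and for integrability.\<close>

lemma abs_zeta_on_le:
  assumes pa: "\<And>l. pa G l \<subseteq> {1..d}" and J: "finite J" "i \<in> J"
    and k: "1 \<le> k" "k < card J" and N: "card J \<le> N"
  shows "\<bar>zeta_on d m G k J xs i\<bar> \<le> (2 * real d + 1) * (1 + ln (real N))"
proof -
  let ?n = "\<lambda>S. ball_count m {1..d} k xs S J i"
  have n: "0 < ?n S" "?n S < N" if "S \<subseteq> {1..d}" for S
    using ball_count_bounds[OF _ J(1) k(1) that J(2) k(2), of m xs] k N by auto
  have D: "\<bar>Digamma (real (?n {1..d}))\<bar> \<le> 1 + ln (real N)"
    using n[OF order_refl] by (intro abs_Digamma_nat_le) auto
  have ln: "\<bar>ln (real (?n S) + 1)\<bar> \<le> 1 + ln (real N)" if "S \<subseteq> {1..d}" for S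
  proof -
    have "real (?n S) + 1 \<le> real N" using n[OF that] by linarith
    then have "ln (real (?n S) + 1) \<le> ln (real N)" by simp
    then show ?thesis by simp
  qed
  have "\<bar>(if pa G l \<noteq> {} then ln (real (?n (pa G l)) + 1) else 0)
      - ln (real (?n (insert l (pa G l))) + 1)\<bar> \<le> 2 * (1 + ln (real N))"
    if l: "l \<in> {1..d}" for l
  proof -
    have "insert l (pa G l) \<subseteq> {1..d}" using pa l by simp
    moreover have "\<bar>(if b then u else 0) - v\<bar> \<le> 2 * r" if "\<bar>u\<bar> \<le> r" "\<bar>v\<bar> \<le> r" for b and u v r :: real
      using that by (cases b) auto
    ultimately show ?thesis using ln[OF pa[of l]] ln by blast
  qed
  then have "(\<Sum>l\<in>{1..d}. \<bar>(if pa G l \<noteq> {} then ln (real (?n (pa G l)) + 1) else 0)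
      - ln (real (?n (insert l (pa G l))) + 1)\<bar>) \<le> real (card {1..d}) * (2 * (1 + ln (real N)))"
    by (rule sum_bounded_above)
  then have "\<bar>\<Sum>l\<in>{1..d}. (if pa G l \<noteq> {} then ln (real (?n (pa G l)) + 1) else 0)
      - ln (real (?n (insert l (pa G l))) + 1)\<bar> \<le> real (card {1..d}) * (2 * (1 + ln (real N)))"
    by (rule order_trans[OF sum_abs])
  then have "\<bar>zeta_on d m G k J xs i\<bar> \<le> (1 + ln (real N)) + real (card {1..d}) * (2 * (1 + ln (real N)))"
    unfolding zeta_on_def by (intro order_trans[OF abs_triangle_ineq] add_mono D)
  then show ?thesis by (simp add: algebra_simps)
qed

text \<open>Away from the critical samples the radius is unchanged, so each count drops by one or
  not at all. The weight \<open>w S\<close> is the resulting change of a logarithm, up to the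
  inequality \<open>ln (1 + t) \<le> t\<close>.\<close>

lemma abs_zeta_on_remove_le:
  assumes pa: "\<And>l. pa G l \<subseteq> {1..d}" and J: "finite J" "p \<in> J" "i \<in> J" "i \<noteq> p"
    and k: "1 \<le> k" "k + 2 \<le> card J"
    and not_critical: "\<not> (pdist m {1..d} xs p i \<le> kth_radius k (pdist m {1..d} xs) J i \<and>
      ball_count m {1..d} k xs {1..d} J i \<le> k)"
    and w: "\<And>S. w S = (if pdist m S xs p i \<le> kth_radius k (pdist m {1..d} xs) J i
      then 1 / real (ball_count m {1..d} k xs S J i) else 0)"
  shows "\<bar>zeta_on d m G k J xs i - zeta_on d m G k (J - {p}) xs i\<bar>
    \<le> 2 * w {1..d} + (\<Sum>l\<in>{1..d}. w (pa G l) + w (insert l (pa G l)))"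
proof -
  let ?n = "\<lambda>S. ball_count m {1..d} k xs S J i"
  let ?n' = "\<lambda>S. ball_count m {1..d} k xs S (J - {p}) i"
  have n: "?n S = ?n' S + (if pdist m S xs p i \<le> kth_radius k (pdist m {1..d} xs) J i then 1 else 0)" for S
    using J k not_critical by (intro ball_count_remove) auto
  have ge: "k \<le> ?n' S" if "S \<subseteq> {1..d}" for S
    using J k that by (intro ball_count_bounds) auto
  have w0: "0 \<le> w S" for S unfolding w by simp
  have D: "\<bar>Digamma (real (?n {1..d})) - Digamma (real (?n' {1..d}))\<bar> \<le> 2 * w {1..d}"
  proof (cases "pdist m {1..d} xs p i \<le> kth_radius k (pdist m {1..d} xs) J i")
    case True
    define q where "q = ?n' {1..d}"
    have q: "1 \<le> q" unfolding q_def using ge[OF order_refl] k(1) by linarith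
    have "?n {1..d} = q + 1" using True n unfolding q_def by simp
    moreover have "Digamma (real q + 1) = Digamma (real q) + 1 / real q"
      using q by (intro Digamma_plus1) simp
    \<comment> \<open>\<open>Digamma\<close> changes by the inverse of the count after the removal,
      whereas \<open>w\<close> uses the count before it; this costs the factor 2.\<close>
    moreover have "1 / real q \<le> 2 * (1 / real (q + 1))"
      using q by (simp add: field_simps)
    ultimately show ?thesis using True unfolding w q_def[symmetric] by (simp add: add.commute)
  next
    case False
    then show ?thesis using n[of "{1..d}"] w0[of "{1..d}"] by simp
  qed
  have ln: "\<bar>ln (real (?n S) + 1) - ln (real (?n' S) + 1)\<bar> \<le> w S" for S
  proof (cases "pdist m S xs p i \<le> kth_radius k (pdist m {1..d} xs) J i")
    case True
    then have "?n S = ?n' S + 1" using n by simp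
    then show ?thesis using True ln_Suc_diff_le[of "?n S"] unfolding w by (simp add: add.commute)
  next
    case False
    then show ?thesis using n[of S] w0[of S] by simp
  qed
  let ?t = "\<lambda>b l. (if pa G l \<noteq> {} then ln (real (b (pa G l)) + 1) else 0) -
        ln (real (b (insert l (pa G l))) + 1)"
  have t: "\<bar>?t ?n l - ?t ?n' l\<bar> \<le> w (pa G l) + w (insert l (pa G l))" for l
    using ln[of "pa G l"] ln[of "insert l (pa G l)"] w0[of "pa G l"] by (auto simp: abs_le_iff)
  have "\<bar>(\<Sum>l\<in>{1..d}. ?t ?n l) - (\<Sum>l\<in>{1..d}. ?t ?n' l)\<bar>
      \<le> (\<Sum>l\<in>{1..d}. w (pa G l) + w (insert l (pa G l)))"
    unfolding sum_subtractf[symmetric] by (intro order_trans[OF sum_abs] sum_mono t)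
  then show ?thesis using D unfolding zeta_on_def by linarith
qed

text \<open>Three contributions: the term of \<open>p\<close> itself, at most \<open>B\<close>; the
  at most \<open>Q * k\<close> critical samples, at most \<open>2 * B\<close> each; and the weights
  \<open>W\<close>, which add up to harmonic sums.\<close>

lemma abs_sum_zeta_on_remove_le:
  assumes pa: "\<And>l. pa G l \<subseteq> {1..d}" and J: "finite J" "p \<in> J" "card J = N"
    and k: "1 \<le> k" "k + 2 \<le> N"
  shows "\<bar>(\<Sum>i\<in>J. zeta_on d m G k J xs i) - (\<Sum>i\<in>J - {p}. zeta_on d m G k (J - {p}) xs i)\<bar>
    \<le> real (8 * d + 5) * real (n_orthants m {1..d}) * real k * (1 + ln (real N))"
proof -
  define L where "L = 1 + ln (real N)"
  define Q where "Q = n_orthants m {1..d}"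
  define B where "B = (2 * real d + 1) * L"
  let ?z = "zeta_on d m G k J xs" and ?z' = "zeta_on d m G k (J - {p}) xs"
  define crit where "crit = {i\<in>J - {p}. pdist m {1..d} xs p i \<le> kth_radius k (pdist m {1..d} xs) J i \<and>
      ball_count m {1..d} k xs {1..d} J i \<le> k}"
  define w where "w i S = (if pdist m S xs p i \<le> kth_radius k (pdist m {1..d} xs) J i
      then 1 / real (ball_count m {1..d} k xs S J i) else 0)" for i S
  define W where "W i = 2 * w i {1..d} + (\<Sum>l\<in>{1..d}. w i (pa G l) + w i (insert l (pa G l)))" for i
  have L: "1 \<le> L" unfolding L_def using k by simp
  have Q1: "1 \<le> Q" unfolding Q_def n_orthants_def by simp
  have B0: "0 \<le> B" unfolding B_def using L by simp
  have card: "card (J - {p}) = N - 1" using J by simp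
  have z: "\<bar>?z i\<bar> \<le> B" if "i \<in> J" for i
    unfolding B_def L_def using J k that by (intro abs_zeta_on_le pa) auto
  have z': "\<bar>?z' i\<bar> \<le> B" if "i \<in> J - {p}" for i
    unfolding B_def L_def using J k that card by (intro abs_zeta_on_le pa) auto
  have w0: "0 \<le> w i S" for i S unfolding w_def by simp
  have W0: "0 \<le> W i" for i unfolding W_def using w0 by (simp add: sum_nonneg)
  have diff: "\<bar>?z i - ?z' i\<bar> \<le> (if i \<in> crit then 2 * B else 0) + W i" if i: "i \<in> J - {p}" for i
  proof (cases "i \<in> crit")
    case True
    then show ?thesis using z[of i] z'[OF i] i W0[of i] by auto
  next
    case False
    then have "\<bar>?z i - ?z' i\<bar> \<le> W i"
      unfolding W_def using i J k
      by (intro abs_zeta_on_remove_le pa) (auto simp: crit_def w_def)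
    then show ?thesis using False by simp
  qed
  have sum_w: "(\<Sum>i\<in>J - {p}. w i S) \<le> real Q * L" if "S \<subseteq> {1..d}" for S
    unfolding w_def Q_def L_def J(3)[symmetric]
    using J k that by (intro sum_inverse_ball_count_le) auto
  have "(\<Sum>i\<in>J - {p}. W i) = 2 * (\<Sum>i\<in>J - {p}. w i {1..d})
      + (\<Sum>l\<in>{1..d}. (\<Sum>i\<in>J - {p}. w i (pa G l)) + (\<Sum>i\<in>J - {p}. w i (insert l (pa G l))))"
    \<comment> \<open>Summing over the samples first lets \<open>sum_w\<close> be applied to one set
      of components at a time.\<close>
    unfolding W_def sum.distrib sum_distrib_left
    by (subst (2 3) sum.swap) simp
  also have "\<dots> \<le> 2 * (real Q * L) + (\<Sum>l\<in>{1..d}. real Q * L + real Q * L)"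
    using pa by (intro add_mono mult_left_mono sum_mono sum_w) auto
  also have "\<dots> = (2 * real d + 2) * (real Q * L)" by (simp add: algebra_simps)
  finally have sum_W: "(\<Sum>i\<in>J - {p}. W i) \<le> (2 * real d + 2) * (real Q * L)" .
  have "card crit \<le> Q * k"
    unfolding crit_def Q_def using J k by (intro card_critical_le) auto
  then have crit: "real (card crit) \<le> real Q * real k"
    by (metis of_nat_mono of_nat_mult)
  have "finite crit" unfolding crit_def using J by simp
  have "crit \<subseteq> J - {p}" unfolding crit_def by auto
  have "\<bar>(\<Sum>i\<in>J. ?z i) - (\<Sum>i\<in>J - {p}. ?z' i)\<bar>
      = \<bar>?z p + (\<Sum>i\<in>J - {p}. ?z i - ?z' i)\<bar>"
    using J by (simp add: sum.remove sum_subtractf)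
  also have "\<dots> \<le> \<bar>?z p\<bar> + (\<Sum>i\<in>J - {p}. \<bar>?z i - ?z' i\<bar>)"
    using sum_abs[of "\<lambda>i. ?z i - ?z' i" "J - {p}"] by linarith
  also have "\<dots> \<le> B + (\<Sum>i\<in>J - {p}. (if i \<in> crit then 2 * B else 0) + W i)"
    using J by (intro add_mono z sum_mono diff) auto
  also have "(\<Sum>i\<in>J - {p}. (if i \<in> crit then 2 * B else 0) + W i)
      = real (card crit) * (2 * B) + (\<Sum>i\<in>J - {p}. W i)"
    using \<open>crit \<subseteq> J - {p}\<close> J(1) by (simp add: sum.distrib sum.If_cases Int_absorb1)
  also have "B + \<dots> \<le> B + (real Q * real k * (2 * B) + (2 * real d + 2) * (real Q * L))"
    using B0 crit sum_W by (intro add_mono mult_right_mono) auto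
  \<comment> \<open>Since \<open>Q\<close> and \<open>k\<close> are at least 1, every term can be
    given the common factor \<open>Q * k\<close>.\<close>
  also have "\<dots> \<le> real Q * real k * B + (real Q * real k * (2 * B) + (2 * real d + 2) * (real Q * real k * L))"
  proof (intro add_mono mult_left_mono order_refl)
    have "1 * 1 \<le> real Q * real k" using Q1 k by (intro mult_mono) auto
    then have "1 * B \<le> real Q * real k * B" using B0 by (intro mult_right_mono) auto
    then show "B \<le> real Q * real k * B" by simp
    have "real Q * 1 * L \<le> real Q * real k * L"
      using L k by (intro mult_right_mono mult_left_mono) auto
    then show "real Q * L \<le> real Q * real k * L" by simp
  qed simp_all
  \<comment> \<open>The constant is \<open>3 * (2 * d + 1) + (2 * d + 2)\<close>.\<close>
  also have "\<dots> = real (8 * d + 5) * real Q * real k * L"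
    unfolding B_def by (simp add: algebra_simps)
  finally show ?thesis unfolding Q_def L_def .
qed

section \<open>From removing a sample to replacing it\<close>

lemma gdm_hat_cong:
  assumes "\<And>i. i \<in> {1..N} \<Longrightarrow> xs i = ys i"
  shows "gdm_hat d m G k N xs = gdm_hat d m G k N ys"
  unfolding gdm_hat_def zeta_stat_eq using assms
  by (intro arg_cong2[where f = "(+)"] arg_cong2[where f = "(*)"] sum.cong zeta_on_cong refl) auto

text \<open>Both configurations become the same once the sample \<open>p\<close> is removed, so two
  removals bridge them, whence the factor 2. The additive \<open>ln N\<close> term cancels.\<close>

lemma gdm_hat_bounded_difference:
  assumes pa: "\<And>l. pa G l \<subseteq> {1..d}" and p: "p \<in> {1..N}" and k: "1 \<le> k" "k + 2 \<le> N"
  shows "\<bar>gdm_hat d m G k N xs - gdm_hat d m G k N (xs(p := y))\<bar>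
    \<le> 2 * real (8 * d + 5) * real (n_orthants m {1..d}) * (real k * (1 + ln (real N))) / real N"
proof -
  define c where "c = real (8 * d + 5) * real (n_orthants m {1..d}) * real k * (1 + ln (real N))"
  let ?s = "\<lambda>xs. \<Sum>i\<in>{1..N}. zeta_on d m G k {1..N} xs i"
  let ?s' = "\<lambda>xs. \<Sum>i\<in>{1..N} - {p}. zeta_on d m G k ({1..N} - {p}) xs i"
  have "\<bar>?s xs - ?s' xs\<bar> \<le> c" for xs
    unfolding c_def using p k by (intro abs_sum_zeta_on_remove_le pa) auto
  from this[of xs] this[of "xs(p := y)"]
  have "\<bar>?s xs - ?s' xs\<bar> \<le> c" "\<bar>?s (xs(p := y)) - ?s' (xs(p := y))\<bar> \<le> c" .
  moreover have "?s' xs = ?s' (xs(p := y))"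
    by (intro sum.cong zeta_on_cong) auto
  ultimately have "\<bar>?s xs - ?s (xs(p := y))\<bar> \<le> 2 * c" by linarith
  moreover have "gdm_hat d m G k N xs - gdm_hat d m G k N (xs(p := y)) = (?s xs - ?s (xs(p := y))) / real N"
    unfolding gdm_hat_def zeta_stat_eq by (simp add: diff_divide_distrib)
  ultimately have "\<bar>gdm_hat d m G k N xs - gdm_hat d m G k N (xs(p := y))\<bar> \<le> 2 * c / real N"
    by (simp only: abs_divide abs_of_nat) (intro divide_right_mono of_nat_0_le_iff)
  also have "2 * c / real N = 2 * real (8 * d + 5) * real (n_orthants m {1..d}) * (real k * (1 + ln (real N))) / real N"
    unfolding c_def by (simp only: mult.assoc)
  finally show ?thesis .
qed

section \<open>Measurability and variance of the estimator\<close>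

text \<open>A sublevel set of the distance is given by finitely many conditions on measurable
  coordinates.\<close>

lemma linf_dist_measurable:
  assumes T: "finite T" "S \<subseteq> T" and ij: "i \<in> J" "j \<in> J"
  shows "(\<lambda>xs. linf_dist m S (xs i) (xs j)) \<in> borel_measurable (\<Pi>\<^sub>M i\<in>J. prod_space m T)"
proof (rule borel_measurableI_le)
  fix r :: real
  let ?M = "\<Pi>\<^sub>M i\<in>J. prod_space m T"
  have S: "finite S" using T finite_subset by blast
  have coord: "(\<lambda>xs. xs i l n) \<in> borel_measurable ?M" if "i \<in> J" "l \<in> S" "n < m l" for i l n
  proof -
    have "(\<lambda>xs. xs i) \<in> ?M \<rightarrow>\<^sub>M prod_space m T"
      using that by (intro measurable_component_singleton)
    moreover have "(\<lambda>x. x l) \<in> prod_space m T \<rightarrow>\<^sub>M euclid (m l)"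
      unfolding prod_space_def using that T(2) by (intro measurable_component_singleton) auto
    moreover have "(\<lambda>v. v n) \<in> euclid (m l) \<rightarrow>\<^sub>M borel"
      unfolding euclid_def using that by (intro measurable_component_singleton) auto
    ultimately show ?thesis by (auto intro: measurable_compose)
  qed
  have "{xs \<in> space ?M. 0 \<le> r \<and> (\<forall>l\<in>S. \<forall>n\<in>{..<m l}. \<bar>xs i l n - xs j l n\<bar> \<le> r)} \<in> sets ?M"
    using S coord ij
    by (intro sets.sets_Collect_conj sets.sets_Collect_const sets.sets_Collect_finite_All
        borel_measurable_le borel_measurable_const borel_measurable_abs borel_measurable_diff) auto
  then show "{xs \<in> space ?M. linf_dist m S (xs i) (xs j) \<le> r} \<in> sets ?M"
    unfolding linf_dist_le_iff[OF S] by (simp only: lessThan_iff Ball_def)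
qed

lemma card_nbrs_measurable:
  assumes T: "finite T" "S \<subseteq> T" and i: "i \<in> J"
    and r[measurable]: "r \<in> borel_measurable (\<Pi>\<^sub>M i\<in>J. prod_space m T)"
  shows "(\<lambda>xs. card (nbrs (pdist m S xs) J (r xs) i))
    \<in> (\<Pi>\<^sub>M i\<in>J. prod_space m T) \<rightarrow>\<^sub>M count_space UNIV"
proof (rule measurable_card)
  fix j
  let ?M = "\<Pi>\<^sub>M i\<in>J. prod_space m T"
  show "{xs \<in> space ?M. j \<in> nbrs (pdist m S xs) J (r xs) i} \<in> sets ?M"
  proof (cases "j \<in> J \<and> j \<noteq> i")
    case True
    then have [measurable]: "(\<lambda>xs. pdist m S xs j i) \<in> borel_measurable ?M"
      using i by (intro linf_dist_measurable T) auto
    have "{xs \<in> space ?M. pdist m S xs j i \<le> r xs} \<in> sets ?M" by measurable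
    then show ?thesis using True unfolding nbrs_def by simp
  next
    case False
    then have "{xs \<in> space ?M. j \<in> nbrs (pdist m S xs) J (r xs) i} = {}" unfolding nbrs_def by auto
    then show ?thesis by (simp only: sets.empty_sets)
  qed
qed

text \<open>A sublevel set of the radius is the event that a ball of fixed radius holds at least
  \<open>k\<close> samples.\<close>

lemma kth_radius_measurable:
  assumes T: "finite T" and J: "finite J" "i \<in> J" and k: "1 \<le> k" "k < card J"
  shows "(\<lambda>xs. kth_radius k (pdist m T xs) J i) \<in> borel_measurable (\<Pi>\<^sub>M i\<in>J. prod_space m T)"
proof (rule borel_measurableI_le)
  fix r :: real
  let ?M = "\<Pi>\<^sub>M i\<in>J. prod_space m T"
  have [measurable]: "(\<lambda>xs. card (nbrs (pdist m T xs) J r i)) \<in> ?M \<rightarrow>\<^sub>M count_space UNIV"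
    using T J by (intro card_nbrs_measurable) auto
  have "{xs \<in> space ?M. k \<le> card (nbrs (pdist m T xs) J r i)} \<in> sets ?M" by measurable
  then show "{xs \<in> space ?M. kth_radius k (pdist m T xs) J i \<le> r} \<in> sets ?M"
    using J k by (simp add: kth_radius_le_iff)
qed

lemma gdm_hat_measurable:
  assumes pa: "\<And>l. pa G l \<subseteq> {1..d}" and k: "1 \<le> k" "k < N"
  shows "gdm_hat d m G k N \<in> borel_measurable (\<Pi>\<^sub>M i\<in>{1..N}. prod_space m {1..d})"
proof -
  let ?M = "\<Pi>\<^sub>M i\<in>{1..N}. prod_space m {1..d}"
  \<comment> \<open>The counts take values in a discrete space, so any function of them is
    measurable; this covers \<open>ln\<close> and \<open>Digamma\<close> alike.\<close>
  have *: "(\<lambda>xs. F (ball_count m {1..d} k xs S {1..N} i)) \<in> borel_measurable ?M"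
    if "S \<subseteq> {1..d}" "i \<in> {1..N}" for F :: "nat \<Rightarrow> real" and S i
  proof -
    have "(\<lambda>xs. kth_radius k (pdist m {1..d} xs) {1..N} i) \<in> borel_measurable ?M"
      using that k by (intro kth_radius_measurable) auto
    then have "(\<lambda>xs. ball_count m {1..d} k xs S {1..N} i) \<in> ?M \<rightarrow>\<^sub>M count_space UNIV"
      unfolding ball_count_def using that by (intro card_nbrs_measurable) auto
    then show ?thesis by (rule measurable_compose) simp
  qed
  have "(\<lambda>xs. if pa G l \<noteq> {} then ln (real (ball_count m {1..d} k xs (pa G l) {1..N} i) + 1) else 0)
      \<in> borel_measurable ?M" if "i \<in> {1..N}" for l i
    using *[OF pa that, of "\<lambda>n. ln (real n + 1)" l] by (cases "pa G l = {}") auto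
  moreover have "(\<lambda>xs. ln (real (ball_count m {1..d} k xs (insert l (pa G l)) {1..N} i) + 1))
      \<in> borel_measurable ?M" if "i \<in> {1..N}" "l \<in> {1..d}" for l i
    using *[of "insert l (pa G l)" i "\<lambda>n. ln (real n + 1)"] pa that by auto
  moreover have "(\<lambda>xs. Digamma (real (ball_count m {1..d} k xs {1..d} {1..N} i)))
      \<in> borel_measurable ?M" if "i \<in> {1..N}" for i
    using *[of "{1..d}" i "\<lambda>n. Digamma (real n)"] that by simp
  ultimately show ?thesis
    unfolding gdm_hat_def zeta_stat_eq zeta_on_def
    by (intro borel_measurable_add borel_measurable_times borel_measurable_sum
        borel_measurable_diff borel_measurable_const) auto
qed

text \<open>By independence the samples have the product law, where the bounded differences
  inequality gives \<open>N * c^2\<close> with \<open>c\<close> of order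
  \<open>k * (1 + ln N) / N\<close>.\<close>

lemma gdm_hat_variance_le:
  fixes M :: "'w measure" and x :: "nat \<Rightarrow> 'w \<Rightarrow> nat \<Rightarrow> nat \<Rightarrow> real"
  assumes pa: "\<And>l. pa G l \<subseteq> {1..d}" and k: "1 \<le> k" "k + 2 \<le> N"
    and P: "prob_space P" "sets P = sets (prod_space m {1..d})"
    and M: "prob_space M"
    and indep: "prob_space.indep_vars M (\<lambda>_. prod_space m {1..d}) x {1..N}"
    and law: "\<And>i. i \<in> {1..N} \<Longrightarrow> distr M (prod_space m {1..d}) (x i) = P"
  shows "prob_space.variance M (\<lambda>\<omega>. gdm_hat d m G k N (\<lambda>i. x i \<omega>))
    \<le> (2 * real (8 * d + 5) * real (n_orthants m {1..d}))\<^sup>2 * ((real k * (1 + ln (real N)))\<^sup>2 / real N)"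
proof -
  interpret M: prob_space M by fact
  interpret PP: product_prob_space "\<lambda>_. P" "{1..N}"
    using P(1) by (simp add: product_prob_space_def product_prob_space_axioms_def
        product_sigma_finite_def prob_space_imp_sigma_finite)
  define c where "c = 2 * real (8 * d + 5) * real (n_orthants m {1..d}) * (real k * (1 + ln (real N))) / real N"
  let ?S = "prod_space m {1..d}" and ?f = "gdm_hat d m G k N"
  let ?L = "\<Pi>\<^sub>M i\<in>{1..N}. P" and ?L' = "\<Pi>\<^sub>M i\<in>{1..N}. ?S"
  let ?X = "\<lambda>\<omega>. \<lambda>i\<in>{1..N}. x i \<omega>"
  have rv: "x i \<in> M \<rightarrow>\<^sub>M ?S" if "i \<in> {1..N}" for i
    using indep that by (auto simp: M.indep_vars_def)
  have X: "?X \<in> M \<rightarrow>\<^sub>M ?L'" using rv by (intro measurable_restrict)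
  have "distr M ?L' ?X = (\<Pi>\<^sub>M i\<in>{1..N}. distr M ?S (x i))"
    using indep rv k by (subst (asm) M.indep_vars_iff_distr_eq_PiM') auto
  also have "\<dots> = ?L" by (intro PiM_cong law refl)
  finally have distr: "distr M ?L' ?X = ?L" .
  have f: "?f \<in> borel_measurable ?L'" using k by (intro gdm_hat_measurable pa) auto
  have "sets ?L = sets ?L'" using P(2) by (intro sets_PiM_cong) auto
  then have f': "?f \<in> borel_measurable ?L" using f by (simp cong: measurable_cong_sets)
  \<comment> \<open>The estimator reads only the samples with index in \<open>{1..N}\<close>, so its
    argument may be restricted to a point of the product space.\<close>
  have eq: "?f (\<lambda>i. x i \<omega>) = ?f (?X \<omega>)" for \<omega> by (intro gdm_hat_cong) simp
  have transfer: "(\<integral>\<omega>. h (?f (?X \<omega>)) \<partial>M) = (\<integral>xs. h (?f xs) \<partial>?L)"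
    if [measurable]: "h \<in> borel_measurable borel" for h :: "real \<Rightarrow> real"
    unfolding distr[symmetric] using X measurable_compose[OF f that] by (subst integral_distr) auto
  obtain B where B: "\<bar>?f xs\<bar> \<le> B" for xs
  proof
    fix xs
    define b where "b = (2 * real d + 1) * (1 + ln (real N))"
    have "\<bar>zeta_on d m G k {1..N} xs i\<bar> \<le> b" if "i \<in> {1..N}" for i
      unfolding b_def using k that by (intro abs_zeta_on_le pa) auto
    then have "\<bar>\<Sum>i\<in>{1..N}. zeta_on d m G k {1..N} xs i\<bar> \<le> real (card {1..N}) * b"
      by (intro order_trans[OF sum_abs] sum_bounded_above)
    then have "\<bar>1 / real N * (\<Sum>i\<in>{1..N}. zeta_on d m G k {1..N} xs i)\<bar> \<le> b"
      using k by (simp add: field_simps)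
    then show "\<bar>?f xs\<bar> \<le> b + \<bar>((\<Sum>l\<in>{1..d}. if pa G l = {} then 1 else 0) - 1) * ln (real N)\<bar>"
      unfolding gdm_hat_def zeta_stat_eq by (rule order_trans[OF abs_triangle_ineq add_right_mono])
  qed
  have sq: "\<bar>(?f xs)\<^sup>2\<bar> \<le> B\<^sup>2" for xs
    using power_mono[OF B, where n = 2] by simp
  have int: "integrable ?L ?f"
    using f' B by (intro PP.P.integrable_const_bound[where B = B] AE_I2) auto
  have int2: "integrable ?L (\<lambda>xs. (?f xs)\<^sup>2)"
    using f' sq by (intro PP.P.integrable_const_bound[where B = "B\<^sup>2"] AE_I2) auto
  have mean: "(\<integral>\<omega>. ?f (?X \<omega>) \<partial>M) = (\<integral>xs. ?f xs \<partial>?L)"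
    using transfer[of "\<lambda>y. y"] by simp
  have "M.variance (\<lambda>\<omega>. ?f (\<lambda>i. x i \<omega>)) = PP.P.variance ?f"
    unfolding eq mean by (rule transfer) measurable
  also have "\<dots> = (\<integral>xs. (?f xs)\<^sup>2 \<partial>?L) - (\<integral>xs. ?f xs \<partial>?L)\<^sup>2"
    by (rule PP.P.variance_eq[OF int int2])
  also have "\<dots> \<le> real (card {1..N}) * c\<^sup>2"
    unfolding c_def using k
    by (intro PP.bounded_differences_variance[where B = B] f' B gdm_hat_bounded_difference pa) auto
  also have "\<dots> = (2 * real (8 * d + 5) * real (n_orthants m {1..d}))\<^sup>2
      * ((real k * (1 + ln (real N)))\<^sup>2 / real N)"
    using k unfolding c_def by (simp add: power_divide power_mult_distrib power2_eq_square[of "real N"])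
  finally show ?thesis .
qed

section \<open>Passage to the limit\<close>

theorem theorem2:
  fixes d :: nat and m :: "nat \<Rightarrow> nat" and G :: "(nat \<times> nat) set"
    and P Pbar :: "(nat \<Rightarrow> nat \<Rightarrow> real) measure"
    and k :: "nat \<Rightarrow> nat"
    and M :: "'w measure" and x :: "nat \<Rightarrow> nat \<Rightarrow> 'w \<Rightarrow> nat \<Rightarrow> nat \<Rightarrow> real"
  assumes dag: "is_dag d G"
    and P: "prob_space P" "sets P = sets (prod_space m {1..d})"
    and Pbar: "graph_induced_law d m G P Pbar"
    and ac: "absolutely_continuous Pbar P"
    and M: "prob_space M"
    and indep: "\<And>N. prob_space.indep_vars M (\<lambda>_. prod_space m {1..d}) (x N) {1..N}"
    and law: "\<And>N i. i \<in> {1..N} \<Longrightarrow> distr M (prod_space m {1..d}) (x N i) = P"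
    and k_pos: "\<And>N. k N \<ge> 1"
    and k_lim: "filterlim k at_top sequentially"
      "(\<lambda>N. real (k N) * ln (real N) / real N) \<longlonglongrightarrow> 0"
    and discrete: "finite {p \<in> space (prod_space m {1..d}). measure P {p} > 0}"
    and log_int: "(\<integral>\<^sup>+p. ennreal \<bar>ln (enn2real (RN_deriv Pbar P p))\<bar> \<partial>P) < \<infinity>"
    and k_sq: "(\<lambda>N. (real (k N) * ln (real N))\<^sup>2 / real N) \<longlonglongrightarrow> 0"
  shows "(\<lambda>N. prob_space.variance M (\<lambda>\<omega>. gdm_hat d m G (k N) N (\<lambda>i. x N i \<omega>))) \<longlonglongrightarrow> 0"
proof (rule tendsto_sandwich[where f = "\<lambda>_. 0"])
  interpret M: prob_space M by fact
  define C where "C = (2 * real (8 * d + 5) * real (n_orthants m {1..d}))\<^sup>2"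
  show "(\<lambda>N. C * (4 * ((real (k N) * ln (real N))\<^sup>2 / real N))) \<longlonglongrightarrow> 0"
    using tendsto_mult[OF tendsto_const[of C] tendsto_mult[OF tendsto_const[of 4] k_sq]] by simp
  show "\<forall>\<^sub>F N in sequentially. 0 \<le> M.variance (\<lambda>\<omega>. gdm_hat d m G (k N) N (\<lambda>i. x N i \<omega>))"
    by (intro always_eventually allI M.variance_positive)
  \<comment> \<open>Together with \<open>1 \<le> ln N\<close> this gives \<open>k N < N / 2\<close>,
    and then \<open>k N + 2 \<le> N\<close> as soon as \<open>4 \<le> N\<close>.\<close>
  have "\<forall>\<^sub>F N in sequentially. real (k N) * ln (real N) / real N < 1 / 2"
    by (rule order_tendstoD(2)[OF k_lim(2)]) simp
  moreover have "filterlim (\<lambda>N. ln (real N)) at_top sequentially"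
    by (rule filterlim_compose[OF ln_at_top filterlim_real_sequentially])
  then have "\<forall>\<^sub>F N in sequentially. 1 \<le> ln (real N)"
    unfolding filterlim_at_top by blast
  ultimately show "\<forall>\<^sub>F N in sequentially. M.variance (\<lambda>\<omega>. gdm_hat d m G (k N) N (\<lambda>i. x N i \<omega>))
      \<le> C * (4 * ((real (k N) * ln (real N))\<^sup>2 / real N))"
    using eventually_ge_at_top[of 4]
  proof eventually_elim
    case (elim N)
    have "real (k N) * 1 \<le> real (k N) * ln (real N)" using elim by (intro mult_left_mono) auto
    also have "\<dots> < real N / 2" using elim by (simp add: field_simps)
    finally have kN: "k N + 2 \<le> N" using elim(3) by simp
    have "M.variance (\<lambda>\<omega>. gdm_hat d m G (k N) N (\<lambda>i. x N i \<omega>))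
        \<le> C * ((real (k N) * (1 + ln (real N)))\<^sup>2 / real N)"
      unfolding C_def
      by (rule gdm_hat_variance_le[OF pa_subset[OF dag] k_pos kN P M indep law])
    \<comment> \<open>\<open>1 + ln N \<le> 2 * ln N\<close> once \<open>1 \<le> ln N\<close>;
      squaring produces the factor 4.\<close>
    also have "(real (k N) * (1 + ln (real N)))\<^sup>2 \<le> (real (k N) * (2 * ln (real N)))\<^sup>2"
      using elim by (intro power_mono mult_left_mono) auto
    also have "\<dots> = 4 * (real (k N) * ln (real N))\<^sup>2" by (simp add: power_mult_distrib)
    finally show ?case
      unfolding C_def by (simp add: mult_left_mono divide_right_mono)
  qed
qed simp

end
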